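(* Let $\mathcal D_2\subset\mathcal D_1$ be an inclusion of graded algebras and $M$ a $\mathcal D_1$-module which is semisimple as a $\mathcal D_1$-module, semisimple as a $\mathcal D_2$-module, and such that $\mathrm{Ann}_{\mathcal D_2^-}(M)$ generates $M$ over $\mathcal D_2$. Let $N$ be a $\mathcal D_1$-submodule of $M$. (1) If the restriction of $N_1^{ann}$ to a $\mathcal D_2^0$-module is simple, then $J_+(N)$ is a simple $\mathcal D_2$-module. This holds for example if $N_1^{ann}$ is a $1$-dimensional complex vector space. (2) If $N_1^{ann}$ is regarded as a $\mathcal D_2^0$-module by restriction, then $N_1^{ann}=(J_+(N))_2^{ann}$.
   Context: $\mathcal D_2\subset\mathcal D_1$ are associative unital $\mathbb C$-algebras with an element $\nabla\in\mathcal D_2$ whose adjoint action on $\mathcal D_1$ is semisimple with integer eigenvalues; both are graded by $\mathcal D_i(n)=\{P\in\mathcal D_i:[\nabla,P]=nP\}$, so the inclusion is graded. $\mathcal D_i^-=\bigoplus_{n<0}\mathcal D_i(n)$ and $\mathcal D_i^0=\mathcal D_i(0)$; thus $\mathcal D_2^-\subset\mathcal D_1^-$ and $\mathcal D_2^0\subset\mathcal D_1^0$. It is assumed that $\nabla$ acts semisimply on $M$. For a $\mathcal D_i$-submodule $N\subset M$, $N_i^{ann}=\mathrm{Ann}_{\mathcal D_i^-}(N)=\{n\in N:\mathcal D_i^-n=0\}$, a $\mathcal D_i^0$-module. For a $\mathcal D_1$-submodule $N\subset M$, $J_+(N)=\mathcal D_2\cdot N_1^{ann}$, a $\mathcal D_2$-submodule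 of $M$. *)

theory Defs
  imports Complex_Main
begin

section \<open>Complex algebras and their modules\<close>

locale complex_algebra = vector_space scale
  for scale :: "complex \<Rightarrow> 'a::ring_1 \<Rightarrow> 'a" +
  assumes scale_mult_left: "scale c a * b = scale c (a * b)"
    and scale_mult_right: "a * scale c b = scale c (a * b)"

definition subalgebra :: "(complex \<Rightarrow> 'a::ring_1 \<Rightarrow> 'a) \<Rightarrow> 'a set \<Rightarrow> bool" where
  "subalgebra sA D \<longleftrightarrow> module.subspace sA D \<and> 1 \<in> D \<and> (\<forall>a\<in>D. \<forall>b\<in>D. a * b \<in> D)"

text \<open>By \<open>act_one\<close> and \<open>act_scale\<close>, \<open>sM c m = act (sA c 1) m\<close>, so the complex structure
  on the module is the one induced by the algebra.\<close>

locale algebra_module = alg: complex_algebra sA + vec: vector_space sM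
  for sA :: "complex \<Rightarrow> 'a::ring_1 \<Rightarrow> 'a"
    and sM :: "complex \<Rightarrow> 'm::ab_group_add \<Rightarrow> 'm" +
  fixes act :: "'a \<Rightarrow> 'm \<Rightarrow> 'm"
  assumes act_add_left: "act (a + b) m = act a m + act b m"
    and act_add_right: "act a (m + n) = act a m + act a n"
    and act_mult: "act (a * b) m = act a (act b m)"
    and act_one: "act 1 m = m"
    and act_scale: "act (sA c a) m = sM c (act a m)"

text \<open>In the following definitions \<open>D\<close> is (the carrier of) a subalgebra, and the module is
  regarded as a \<open>D\<close>-module by restriction; the whole algebra is \<open>D = UNIV\<close>.\<close>

definition submodule ::
  "(complex \<Rightarrow> 'm::ab_group_add \<Rightarrow> 'm) \<Rightarrow> ('a \<Rightarrow> 'm \<Rightarrow> 'm) \<Rightarrow> 'a set \<Rightarrow> 'm set \<Rightarrow> bool" where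
  "submodule sM act D N \<longleftrightarrow> module.subspace sM N \<and> (\<forall>P\<in>D. \<forall>m\<in>N. act P m \<in> N)"

definition simple_submodule ::
  "(complex \<Rightarrow> 'm::ab_group_add \<Rightarrow> 'm) \<Rightarrow> ('a \<Rightarrow> 'm \<Rightarrow> 'm) \<Rightarrow> 'a set \<Rightarrow> 'm set \<Rightarrow> bool" where
  "simple_submodule sM act D N \<longleftrightarrow>
     submodule sM act D N \<and> N \<noteq> {0} \<and>
     (\<forall>K. submodule sM act D K \<and> K \<subseteq> N \<longrightarrow> K = {0} \<or> K = N)"

text \<open>\<open>N\<close> is the internal direct sum of a set \<open>S\<close> of simple submodules.\<close>

definition semisimple_submodule ::
  "(complex \<Rightarrow> 'm::ab_group_add \<Rightarrow> 'm) \<Rightarrow> ('a \<Rightarrow> 'm \<Rightarrow> 'm) \<Rightarrow> 'a set \<Rightarrow> 'm set \<Rightarrow> bool" where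
  "semisimple_submodule sM act D N \<longleftrightarrow>
     (\<exists>S. (\<forall>K\<in>S. simple_submodule sM act D K) \<and>
          module.span sM (\<Union>S) = N \<and>
          (\<forall>K\<in>S. K \<inter> module.span sM (\<Union>(S - {K})) = {0}))"

text \<open>\<open>D \<cdot> X\<close>: the finite sums of elements \<open>P x\<close> with \<open>P \<in> D\<close>, \<open>x \<in> X\<close>.\<close>

definition generated ::
  "(complex \<Rightarrow> 'm::ab_group_add \<Rightarrow> 'm) \<Rightarrow> ('a \<Rightarrow> 'm \<Rightarrow> 'm) \<Rightarrow> 'a set \<Rightarrow> 'm set \<Rightarrow> 'm set" where
  "generated sM act D X = module.span sM {act P x | P x. P \<in> D \<and> x \<in> X}"


section \<open>Grading by the adjoint action of \<open>nabla\<close>\<close>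

text \<open>Over the complex numbers an operator is semisimple iff the space is the sum (automatically
  direct) of its eigenspaces; the space may be infinite-dimensional.\<close>

definition semisimple_operator ::
  "(complex \<Rightarrow> 'v::ab_group_add \<Rightarrow> 'v) \<Rightarrow> ('v \<Rightarrow> 'v) \<Rightarrow> bool" where
  "semisimple_operator s T \<longleftrightarrow> module.span s {v. \<exists>c. T v = s c v} = UNIV"

definition commutator :: "'a::ring \<Rightarrow> 'a \<Rightarrow> 'a" where
  "commutator a b = a * b - b * a"

text \<open>\<open>D\<^sub>1\<close> is the whole type \<open>'a\<close>. The eigenspace decompositions of \<open>D\<^sub>1\<close> and of \<open>D\<^sub>2\<close> under
  \<open>[nabla, _]\<close> follow: \<open>D\<^sub>2\<close> is stable under \<open>[nabla, _]\<close> since \<open>nabla \<in> D\<^sub>2\<close>, and a subspace stable under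
  a semisimple operator is the sum of its intersections with the eigenspaces.\<close>

definition graded_inclusion ::
  "(complex \<Rightarrow> 'a::ring_1 \<Rightarrow> 'a) \<Rightarrow> 'a \<Rightarrow> 'a set \<Rightarrow> bool" where
  "graded_inclusion sA nabla D2 \<longleftrightarrow>
     complex_algebra sA \<and> subalgebra sA D2 \<and> nabla \<in> D2 \<and>
     semisimple_operator sA (commutator nabla) \<and>
     (\<forall>c P. P \<noteq> 0 \<and> commutator nabla P = sA c P \<longrightarrow> c \<in> \<int>)"

definition degree_part ::
  "(complex \<Rightarrow> 'a::ring_1 \<Rightarrow> 'a) \<Rightarrow> 'a \<Rightarrow> 'a set \<Rightarrow> int \<Rightarrow> 'a set" where
  "degree_part sA nabla D n = {P \<in> D. commutator nabla P = sA (of_int n) P}"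

definition negative_part ::
  "(complex \<Rightarrow> 'a::ring_1 \<Rightarrow> 'a) \<Rightarrow> 'a \<Rightarrow> 'a set \<Rightarrow> 'a set" where
  "negative_part sA nabla D = module.span sA (\<Union>n\<in>{..<0}. degree_part sA nabla D n)"

abbreviation zero_part ::
  "(complex \<Rightarrow> 'a::ring_1 \<Rightarrow> 'a) \<Rightarrow> 'a \<Rightarrow> 'a set \<Rightarrow> 'a set" where
  "zero_part sA nabla D \<equiv> degree_part sA nabla D 0"

definition ann ::
  "(complex \<Rightarrow> 'a::ring_1 \<Rightarrow> 'a) \<Rightarrow> ('a \<Rightarrow> 'm::ab_group_add \<Rightarrow> 'm) \<Rightarrow> 'a \<Rightarrow> 'a set \<Rightarrow> 'm set \<Rightarrow> 'm set"
  where
  "ann sA act nabla D N = {m \<in> N. \<forall>P\<in>negative_part sA nabla D. act P m = 0}"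

definition J_plus ::
  "(complex \<Rightarrow> 'a::ring_1 \<Rightarrow> 'a) \<Rightarrow> (complex \<Rightarrow> 'm::ab_group_add \<Rightarrow> 'm) \<Rightarrow> ('a \<Rightarrow> 'm \<Rightarrow> 'm) \<Rightarrow>
   'a \<Rightarrow> 'a set \<Rightarrow> 'm set \<Rightarrow> 'm set" where
  "J_plus sA sM act nabla D2 N = generated sM act D2 (ann sA act nabla UNIV N)"


section \<open>The annihilator and \<open>J\<^sub>+\<close> are submodules\<close>

context algebra_module
begin

lemma act_scale_right: "act a (sM c m) = sM c (act a m)"
proof -
  have "act a (sM c m) = act a (act (sA c 1) m)"
    by (simp add: act_scale act_one)
  also have "\<dots> = act (sA c a) m"
    by (simp add: act_mult [symmetric] alg.scale_mult_right)
  finally show ?thesis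
    by (simp add: act_scale)
qed

lemma act_zero_right: "act a 0 = 0"
  using act_add_right [of a 0 0] by simp

lemma negative_part_mult_zero_part:
  assumes D: "subalgebra sA D" and P: "P \<in> negative_part sA nabla D" and Q: "Q \<in> zero_part sA nabla D"
  shows "P * Q \<in> negative_part sA nabla D"
  using P unfolding negative_part_def
proof (induction rule: alg.span_induct_alt)
  case base
  then show ?case by (simp add: alg.span_zero)
next
  case (step c x y)
  then obtain n where n: "n < 0" and x: "x \<in> degree_part sA nabla D n" by auto
  have "nabla * Q = Q * nabla" and Q': "Q \<in> D"
    using Q by (auto simp: degree_part_def commutator_def)
  then have "commutator nabla (x * Q) = commutator nabla x * Q"
    by (simp add: commutator_def algebra_simps)
  then have "x * Q \<in> degree_part sA nabla D n"
    using x Q' D by (auto simp: degree_part_def subalgebra_def alg.scale_mult_left)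
  with n have "x * Q \<in> alg.span (\<Union>n\<in>{..<0}. degree_part sA nabla D n)"
    by (intro alg.span_base) auto
  then show ?case
    using step by (simp add: distrib_right alg.scale_mult_left alg.span_add alg.span_scale)
qed

lemma submodule_ann:
  assumes D: "subalgebra sA D" and N: "submodule sM act D N"
  shows "submodule sM act (zero_part sA nabla D) (ann sA act nabla D N)"
  unfolding submodule_def
proof (intro conjI ballI)
  show "vec.subspace (ann sA act nabla D N)"
    using N by (auto simp: vec.subspace_def submodule_def ann_def act_add_right act_scale_right
        act_zero_right)
next
  fix Q m
  assume Q: "Q \<in> zero_part sA nabla D" and m: "m \<in> ann sA act nabla D N"
  have "act P (act Q m) = 0" if "P \<in> negative_part sA nabla D" for P
    using negative_part_mult_zero_part [OF D that Q] m by (simp add: ann_def act_mult [symmetric])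
  moreover have "act Q m \<in> N"
    using Q m N by (auto simp: ann_def submodule_def degree_part_def)
  ultimately show "act Q m \<in> ann sA act nabla D N"
    by (simp add: ann_def)
qed

lemma submodule_generated:
  assumes D: "subalgebra sA D"
  shows "submodule sM act D (generated sM act D X)"
  unfolding submodule_def
proof (intro conjI ballI)
  show "vec.subspace (generated sM act D X)"
    by (simp add: generated_def)
next
  fix P m
  assume P: "P \<in> D" and m: "m \<in> generated sM act D X"
  from m show "act P m \<in> generated sM act D X"
    unfolding generated_def
  proof (induction rule: vec.span_induct_alt)
    case base
    then show ?case by (simp add: act_zero_right vec.span_zero)
  next
    case (step c x y)
    then obtain Q z where "x = act Q z" "Q \<in> D" "z \<in> X" by auto
    then have "act P x \<in> vec.span {act P x |P x. P \<in> D \<and> x \<in> X}"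
      using P D by (intro vec.span_base) (auto simp: subalgebra_def act_mult [symmetric])
    then show ?case
      using step by (simp add: act_add_right act_scale_right vec.span_add vec.span_scale)
  qed
qed

end

end

theory Submission
  imports Defs
begin

text \<open>
  Write \<open>A\<close> for the annihilator of \<open>D2\<^sup>-\<close> in the whole module \<open>M\<close>. Its elements are lowest weight
  vectors: \<open>D2\<close> can only raise the \<open>nabla\<close>-eigenvalue of an eigenvector in \<open>A\<close>, and raises it by
  natural numbers. Semisimplicity over \<open>D2\<close> enters in one form only: each nonzero vector
  is avoided by some submodule \<open>Q\<close> that is maximal, so that \<open>L + Q = M\<close> for each submodule \<open>L\<close> not
  contained in \<open>Q\<close> (\<open>semisimple_maximal_submodule_avoiding\<close>). As \<open>nabla \<in> D2\<close>, such a \<open>Q\<close> is stable under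
  \<open>nabla\<close> and contains the eigencomponents of each of its elements; in particular, if \<open>Q\<close> contains
  \<open>v + u\<close> with \<open>v\<close> of eigenvalue \<open>c\<close> and \<open>u\<close> a sum of eigenvectors with eigenvalues \<open>c + 1, c + 2, \<dots>\<close>, then
  \<open>v \<in> Q\<close> (\<open>lowest_component_in_submodule\<close>).

  The key fact is \<open>A \<inter> D2\<^sup>+ M = 0\<close> (\<open>ann_inter_positive_image\<close>). Suppose that \<open>a \<noteq> 0\<close> lies there; it may be taken to be
  an eigenvector, of eigenvalue \<open>c\<close> say. Let \<open>Q\<close> be maximal with \<open>a \<notin> Q\<close> and let \<open>L\<close> be generated
  by the vectors of eigenvalue \<open>c\<close> in \<open>A\<close>. Then \<open>M = L + Q\<close> and \<open>L\<close> has eigenvalues \<open>c, c + 1, \<dots>\<close>, hence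
  \<open>a \<in> D2\<^sup>+ L + Q\<close>, where the eigenvalues of \<open>D2\<^sup>+ L\<close> are \<open>c + 1, c + 2, \<dots>\<close>. Taking the component of
  eigenvalue \<open>c\<close> gives \<open>a \<in> Q\<close>, a contradiction.

  Now let \<open>X \<subseteq> A\<close> be a \<open>D2\<^sup>0\<close>-submodule. Since \<open>D2 = D2\<^sup>- + D2\<^sup>0 + D2\<^sup>+\<close>, we have \<open>D2 X = X + D2\<^sup>+ X\<close>, so the key
  fact yields \<open>A \<inter> D2 X = X\<close> (\<open>ann_generated\<close>). With \<open>X\<close> the annihilator of \<open>D1\<^sup>-\<close> in \<open>N\<close> this is the
  last claim. If moreover \<open>X\<close> is simple, it has a single eigenvalue \<open>c\<close>. A
  submodule \<open>L \<noteq> 0\<close> of \<open>D2 X\<close> meets \<open>X\<close> in \<open>0\<close> or in \<open>X\<close>; in the second case \<open>L = D2 X\<close>. In the first case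
  the eigenvalues of \<open>L\<close> are \<open>c + 1, c + 2, \<dots>\<close>, and a maximal \<open>Q\<close> avoiding some vector of \<open>L\<close> has \<open>L + Q = M\<close>.
  Comparing components of eigenvalue \<open>c\<close> gives \<open>X \<subseteq> Q\<close>, so \<open>L \<subseteq> D2 X \<subseteq> Q\<close>, a contradiction
  (\<open>simple_generated\<close>).
\<close>


section \<open>Eigenvectors of a linear operator\<close>

context vector_space
begin

text \<open>By induction on the number of eigenvalues: applying \<open>T - d\<close> to the sum removes the component of
  eigenvalue \<open>d\<close> and multiplies each other one by a nonzero scalar.\<close>

lemma eigencomponent_in_stable_subspace:
  assumes T: "module_hom scale scale T"
    and W: "subspace W" and stable: "\<And>w. w \<in> W \<Longrightarrow> T w \<in> W"
    and "finite F" and "\<And>c. c \<in> F \<Longrightarrow> T (f c) = scale c (f c)"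
    and "sum f F \<in> W" and "c \<in> F"
  shows "f c \<in> W"
  using assms(4-)
proof (induction F arbitrary: f c rule: finite_induct)
  case empty
  then show ?case by simp
next
  case (insert d F)
  interpret T: module_hom scale scale T by (fact T)
  define g where "g e = scale (e - d) (f e)" for e
  have "T (sum f F) = (\<Sum>e\<in>F. scale e (f e))"
    using insert.prems(1) by (simp add: T.sum)
  then have "T (sum f (insert d F)) - scale d (sum f (insert d F)) = sum g F"
    using insert.hyps insert.prems(1)
    by (simp add: T.add g_def scale_left_diff_distrib sum_subtractf scale_sum_right scale_right_distrib)
  then have "sum g F \<in> W"
    using stable [OF insert.prems(2)] insert.prems(2) W by (metis subspace_diff subspace_scale)
  moreover have "T (g e) = scale e (g e)" if "e \<in> F" for e
    using insert.prems(1) that by (simp add: g_def T.scale mult.commute)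
  ultimately have g: "g e \<in> W" if "e \<in> F" for e
    using insert.IH that by blast
  have F: "f e \<in> W" if "e \<in> F" for e
  proof -
    have "e \<noteq> d" using insert.hyps that by auto
    then have "f e = scale (inverse (e - d)) (g e)" by (simp add: g_def)
    then show ?thesis using subspace_scale [OF W g [OF that]] by metis
  qed
  then have "sum f F \<in> W" by (intro subspace_sum [OF W]) auto
  then have "f d \<in> W"
    using subspace_diff [OF W insert.prems(2), of "sum f F"] insert.hyps by simp
  with F insert.prems(3) show ?case by auto
qed

lemma span_eigenvectors_decomposition:
  assumes T: "module_hom scale scale T"
    and v: "v \<in> span {w. \<exists>c\<in>C. T w = scale c w}"
  obtains F f where "finite F" "F \<subseteq> C" "\<And>c. T (f c) = scale c (f c)" "v = sum f F"
proof -
  interpret T: module_hom scale scale T by (fact T)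
  have "\<exists>F f. finite F \<and> F \<subseteq> C \<and> (\<forall>c. T (f c) = scale c (f c)) \<and> (\<forall>c. c \<notin> F \<longrightarrow> f c = 0) \<and> v = sum f F"
    using v
  proof (induction rule: span_induct_alt)
    case base
    show ?case by (rule exI [of _ "{}"], rule exI [of _ "\<lambda>_. 0"]) simp
  next
    case (step a x y)
    then obtain F f c where F: "finite F" "F \<subseteq> C" "\<forall>c. T (f c) = scale c (f c)"
        "\<forall>c. c \<notin> F \<longrightarrow> f c = 0" "y = sum f F" and c: "c \<in> C" "T x = scale c x"
      by auto
    define g where "g e = (if e = c then scale a x else 0) + f e" for e
    have "sum f F = sum f (insert c F)"
      using F by (intro sum.mono_neutral_left) auto
    then have "scale a x + y = sum g (insert c F)"
      using F by (simp add: g_def sum.distrib)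
    moreover have "\<forall>e. T (g e) = scale e (g e)"
      using F c by (simp add: g_def T.add T.scale scale_right_distrib mult.commute)
    ultimately show ?case
      using F c by (intro exI [of _ "insert c F"] exI [of _ g]) (auto simp: g_def)
  qed
  then show thesis using that by blast
qed

lemma stable_subspace_spanned_by_eigenvectors:
  assumes T: "module_hom scale scale T" and ss: "span {w. \<exists>c. T w = scale c w} = UNIV"
    and W: "subspace W" and stable: "\<And>w. w \<in> W \<Longrightarrow> T w \<in> W"
  shows "W \<subseteq> span {w \<in> W. \<exists>c. T w = scale c w}"
proof
  fix w assume w: "w \<in> W"
  have "w \<in> span {w. \<exists>c\<in>UNIV. T w = scale c w}" using ss by simp
  then obtain F f where F: "finite F" "\<And>c. T (f c) = scale c (f c)" "w = sum f F"
    by (rule span_eigenvectors_decomposition [OF T]) (rule that)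
  have "f c \<in> W" if "c \<in> F" for c
    using eigencomponent_in_stable_subspace [OF T W stable F(1), of f c] F w that by simp
  with F(2) show "w \<in> span {w \<in> W. \<exists>c. T w = scale c w}"
    unfolding F(3) by (intro span_sum span_base) auto
qed

text \<open>As the eigenvalue \<open>c\<close> does not occur in \<open>u\<close>, the vector \<open>v\<close> is an eigencomponent of \<open>v + u\<close>. For \<open>W = {0}\<close> this is
  the independence of eigenvectors with distinct eigenvalues.\<close>

lemma eigenvector_in_stable_subspace:
  assumes T: "module_hom scale scale T"
    and W: "subspace W" and stable: "\<And>w. w \<in> W \<Longrightarrow> T w \<in> W"
    and v: "T v = scale c v" and u: "u \<in> span {w. \<exists>d\<in>C. T w = scale d w}" and "c \<notin> C"
    and "v + u \<in> W"
  shows "v \<in> W"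
proof -
  obtain F f where F: "finite F" "F \<subseteq> C" "\<And>d. T (f d) = scale d (f d)" "u = sum f F"
    using span_eigenvectors_decomposition [OF T u] by blast
  define g where "g d = (if d = c then v else f d)" for d
  have "c \<notin> F" using F \<open>c \<notin> C\<close> by auto
  then have "sum g F = u"
    using F by (auto simp: g_def intro!: sum.cong)
  then have "sum g (insert c F) = v + u"
    using F \<open>c \<notin> F\<close> by (simp add: g_def)
  then have "sum g (insert c F) \<in> W" using \<open>v + u \<in> W\<close> by simp
  moreover have "T (g d) = scale d (g d)" for d using F v by (simp add: g_def)
  ultimately have "g c \<in> W"
    using F(1) eigencomponent_in_stable_subspace [OF T W stable, of "insert c F" g c] by simp
  then show ?thesis by (simp add: g_def)
qed

end


section \<open>Maximal submodules of a semisimple module\<close>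

context algebra_module
begin

lemma act_linear: "module_hom sM sM (act P)"
  by unfold_locales (simp_all add: act_add_right act_scale_right)

lemma act_zero_left: "act 0 m = 0"
  using act_add_left [of 0 0 m] by simp

lemma submodule_span:
  assumes "\<And>P x. P \<in> D \<Longrightarrow> x \<in> X \<Longrightarrow> act P x \<in> vec.span X"
  shows "submodule sM act D (vec.span X)"
  unfolding submodule_def
proof (intro conjI ballI)
  show "vec.subspace (vec.span X)" by simp
next
  fix P m assume P: "P \<in> D" and "m \<in> vec.span X"
  from this(2) show "act P m \<in> vec.span X"
  proof (induction rule: vec.span_induct_alt)
    case base
    then show ?case by (simp add: act_zero_right vec.span_zero)
  next
    case (step c x y)
    then show ?case
      using assms P by (simp add: act_add_right act_scale_right vec.span_add vec.span_scale)
  qed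
qed

lemma submodule_Int:
  "submodule sM act D A \<Longrightarrow> submodule sM act D B \<Longrightarrow> submodule sM act D (A \<inter> B)"
  unfolding submodule_def by (blast intro: vec.subspace_inter)

lemma generated_subset_submodule:
  assumes "submodule sM act D N" and "X \<subseteq> N"
  shows "generated sM act D X \<subseteq> N"
  unfolding generated_def
  using assms by (intro vec.span_minimal) (auto simp: submodule_def)

lemma one_dimensional_submodule_simple:
  assumes X: "submodule sM act D X" and "vec.dim X = 1"
  shows "simple_submodule sM act D X"
proof -
  obtain B where B: "B \<subseteq> X" "vec.independent B" "X \<subseteq> vec.span B" "card B = vec.dim X"
    using vec.basis_exists by blast
  then obtain b where b: "B = {b}" using assms by (metis card_1_singletonE)
  have "b \<noteq> 0" using B b by (simp add: vec.independent_insert)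
  have "K = {0} \<or> K = X" if K: "submodule sM act D K" "K \<subseteq> X" for K
  proof (rule disjCI)
    assume "K \<noteq> X"
    have sub: "vec.subspace K" using K by (simp add: submodule_def)
    show "K = {0}"
    proof (rule ccontr)
      assume "K \<noteq> {0}"
      then obtain k where k: "k \<in> K" "k \<noteq> 0" using vec.subspace_0 [OF sub] by blast
      then obtain a where a: "k = sM a b"
        using K B b by (auto simp: vec.span_singleton)
      with k have "b = sM (inverse a) k" by auto
      then have "b \<in> K" using k(1) sub vec.subspace_scale by metis
      then have "vec.span B \<subseteq> K" using b sub by (intro vec.span_minimal) auto
      with B K \<open>K \<noteq> X\<close> show False by blast
    qed
  qed
  then show ?thesis
    using X B b \<open>b \<noteq> 0\<close> unfolding simple_submodule_def by blast
qed

text \<open>If the module is the direct sum of the simple submodules in \<open>S\<close>, then for \<open>K \<in> S\<close> the sum \<open>Q K\<close> of the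
  others is maximal, since it has the simple complement \<open>K\<close>. A vector in all the \<open>Q K\<close> has only zero
  components, so a nonzero one lies outside some \<open>Q K\<close>.\<close>

lemma semisimple_maximal_submodule_avoiding:
  assumes ss: "semisimple_submodule sM act D UNIV" and v: "v \<noteq> 0"
  obtains Q where "submodule sM act D Q" "v \<notin> Q"
    "\<And>L m. submodule sM act D L \<Longrightarrow> \<not> L \<subseteq> Q \<Longrightarrow> \<exists>l\<in>L. \<exists>q\<in>Q. m = l + q"
proof -
  obtain S where S: "\<forall>K\<in>S. simple_submodule sM act D K"
    and span: "vec.span (\<Union>S) = UNIV"
    and "\<forall>K\<in>S. K \<inter> vec.span (\<Union>(S - {K})) = {0}"
    using ss unfolding semisimple_submodule_def by (elim exE conjE) (rule that)
  then have direct: "K \<inter> vec.span (\<Union>(S - {K})) = {0}" if "K \<in> S" for K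
    using that by (elim bspec)
  have simple: "simple_submodule sM act D K" if "K \<in> S" for K
    using S that by (elim bspec)
  define Q where "Q K = vec.span (\<Union>(S - {K}))" for K
  have sub: "submodule sM act D K" if "K \<in> S" for K
    using simple [OF that] by (simp add: simple_submodule_def)
  have Q: "submodule sM act D (Q K)" for K
    unfolding Q_def
  proof (rule submodule_span)
    fix P x assume P: "P \<in> D" and "x \<in> \<Union>(S - {K})"
    then obtain K' where K': "K' \<in> S - {K}" "x \<in> K'" by (elim UnionE)
    then have "act P x \<in> K'"
      using sub [of K'] P by (simp add: submodule_def)
    with K' have "act P x \<in> \<Union>(S - {K})" by (intro UnionI)
    then show "act P x \<in> vec.span (\<Union>(S - {K}))" by (rule vec.span_base)
  qed
  have decomp: "\<exists>k\<in>K. \<exists>q\<in>Q K. m = k + q" if "K \<in> S" for K m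
  proof -
    have "\<Union>S \<subseteq> K \<union> \<Union>(S - {K})" by blast
    then have "vec.span (\<Union>S) \<subseteq> vec.span (K \<union> \<Union>(S - {K}))" by (rule vec.span_mono)
    then have "m \<in> vec.span (K \<union> \<Union>(S - {K}))" unfolding span by (rule subsetD [OF _ UNIV_I])
    then obtain x y where "x \<in> vec.span K" "y \<in> vec.span (\<Union>(S - {K}))" "m = x + y"
      unfolding vec.span_Un mem_Collect_eq by (elim exE conjE) (rule that)
    moreover have "vec.span K = K"
      using sub [OF \<open>K \<in> S\<close>] by (simp add: submodule_def)
    ultimately show ?thesis unfolding Q_def by (intro bexI [of _ x] bexI [of _ y]) simp_all
  qed
  have "\<exists>K\<in>S. v \<notin> Q K"
  proof (rule ccontr)
    assume neg: "\<not> ?thesis"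
    have "v \<in> vec.span (\<Union>S)" unfolding span by (rule UNIV_I)
    then obtain t r where t: "finite t" "t \<subseteq> \<Union>S" "v = (\<Sum>a\<in>t. sM (r a) a)"
      unfolding vec.span_explicit mem_Collect_eq by (elim exE conjE) (rule that)
    have "\<forall>a\<in>t. \<exists>K. K \<in> S \<and> a \<in> K" using t(2) by blast
    from bchoice [OF this] obtain k where "\<forall>a\<in>t. k a \<in> S \<and> a \<in> k a" by (elim exE) (rule that)
    then have k: "k a \<in> S" "a \<in> k a" if "a \<in> t" for a using that by (simp_all add: Ball_def)
    \<comment> \<open>\<open>g K\<close> is the component of \<open>v\<close> in \<open>K\<close>.\<close>
    define g where "g K = (\<Sum>a | a \<in> t \<and> k a = K. sM (r a) a)" for K
    have g: "g K \<in> K" if "K \<in> k ` t" for K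
    proof -
      from that obtain b where "b \<in> t" "K = k b" by (elim imageE)
      then have K: "vec.subspace K" using sub [OF k(1)] by (simp add: submodule_def)
      show ?thesis unfolding g_def
      proof (rule vec.subspace_sum [OF K], rule vec.subspace_scale [OF K])
        fix a assume "a \<in> {a \<in> t. k a = K}"
        then show "a \<in> K" using k(2) [of a] by simp
      qed
    qed
    have vsum: "v = sum g (k ` t)"
      unfolding g_def t(3) by (rule sum.image_gen [OF t(1)])
    have "g K = 0" if K: "K \<in> k ` t" for K
    proof -
      have KS: "K \<in> S" using K k(1) by (elim imageE) simp
      have "v = g K + sum g (k ` t - {K})"
        unfolding vsum using t(1) K by (intro sum.remove) auto
      have "g K' \<in> Q K" if "K' \<in> k ` t - {K}" for K'
      proof -
        have "K' \<in> S - {K}" "g K' \<in> K'" using that k(1) g [of K'] by blast+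
        then show ?thesis unfolding Q_def by (intro vec.span_base UnionI)
      qed
      then have "sum g (k ` t - {K}) \<in> Q K"
        unfolding Q_def by (rule vec.span_sum)
      moreover have "v \<in> Q K" using neg KS by auto
      ultimately have "v - sum g (k ` t - {K}) \<in> Q K"
        unfolding Q_def by (intro vec.span_diff)
      with \<open>v = g K + sum g (k ` t - {K})\<close> have "g K \<in> Q K" by simp
      then show ?thesis using direct [OF KS] g [OF K] unfolding Q_def by blast
    qed
    then have "sum g (k ` t) = 0" by (rule sum.neutral [OF ballI])
    then show False using vsum v by simp
  qed
  then obtain K where K: "K \<in> S" "v \<notin> Q K" by blast
  have "\<exists>l\<in>L. \<exists>q\<in>Q K. m = l + q" if L: "submodule sM act D L" "\<not> L \<subseteq> Q K" for L m
  proof -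
    \<comment> \<open>\<open>I = K \<inter> (L + Q K)\<close> is a nonzero submodule of the simple module \<open>K\<close>, hence \<open>K \<subseteq> L + Q K\<close>.\<close>
    define I where "I = {k \<in> K. \<exists>l\<in>L. \<exists>q\<in>Q K. k = l + q}"
    have subs: "vec.subspace L" "vec.subspace K" "vec.subspace (Q K)"
      using L Q sub [OF K(1)] by (auto simp: submodule_def)
    obtain l where l: "l \<in> L" "l \<notin> Q K" using L by blast
    obtain k q where kq: "k \<in> K" "q \<in> Q K" "l = k + q" using decomp [OF K(1)] by blast
    have "k = l + (- q)" using kq by simp
    moreover have "- q \<in> Q K" using kq(2) subs(3) by (rule vec.subspace_neg [rotated])
    ultimately have "k \<in> I" using l(1) kq(1) unfolding I_def by blast
    moreover have "k \<noteq> 0" using kq l by auto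
    moreover have "submodule sM act D I"
    proof -
      have "submodule sM act D {l + q |l q. l \<in> L \<and> q \<in> Q K}"
        unfolding submodule_def
      proof (intro conjI ballI)
        show "vec.subspace {l + q |l q. l \<in> L \<and> q \<in> Q K}"
          by (rule vec.subspace_sums [OF subs(1,3)])
      next
        fix P m assume "P \<in> D" "m \<in> {l + q |l q. l \<in> L \<and> q \<in> Q K}"
        then obtain l q where "m = l + q" "act P l \<in> L" "act P q \<in> Q K"
          using L(1) Q [of K] by (auto simp: submodule_def)
        then show "act P m \<in> {l + q |l q. l \<in> L \<and> q \<in> Q K}"
          by (auto simp: act_add_right)
      qed
      moreover have "I = K \<inter> {l + q |l q. l \<in> L \<and> q \<in> Q K}" by (auto simp: I_def)
      ultimately show ?thesis using submodule_Int [OF sub [OF K(1)]] by simp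
    qed
    moreover have "I \<subseteq> K" by (auto simp: I_def)
    ultimately have "I = K"
      using simple [OF K(1)] unfolding simple_submodule_def by blast
    obtain k' q' where m: "k' \<in> K" "q' \<in> Q K" "m = k' + q'" using decomp [OF K(1)] by blast
    then obtain l1 q1 where "l1 \<in> L" "q1 \<in> Q K" "k' = l1 + q1"
      using \<open>I = K\<close> unfolding I_def by blast
    then show ?thesis using m subs
      by (intro bexI [of _ l1] bexI [of _ "q1 + q'"]) (simp_all add: vec.subspace_add add.assoc)
  qed
  then show thesis by (rule that [OF Q K(2)])
qed

end


section \<open>Degrees and eigenvalues\<close>

locale graded_module = algebra_module +
  fixes nabla :: 'a and D2 :: "'a set"
  assumes graded: "graded_inclusion sA nabla D2"
    and nabla_semisimple: "semisimple_operator sM (act nabla)"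
begin

text \<open>This is \<open>D2\<^sup>+ X\<close>, where \<open>D2\<^sup>+\<close> is the sum of the parts of positive degree.\<close>

abbreviation positive_image :: "'b set \<Rightarrow> 'b set" where
  "positive_image X \<equiv> vec.span {act P x |P x n. P \<in> degree_part sA nabla D2 n \<and> n > 0 \<and> x \<in> X}"

abbreviation eigenspace :: "complex \<Rightarrow> 'b set" where
  "eigenspace c \<equiv> {v. act nabla v = sM c v}"

abbreviation shifted_eigenspaces :: "complex \<Rightarrow> int \<Rightarrow> 'b set" where
  "shifted_eigenspaces c k \<equiv> vec.span {v. \<exists>d\<in>{c + of_int n |n. k \<le> n}. act nabla v = sM d v}"

lemma D2: "subalgebra sA D2" and nabla_D2: "nabla \<in> D2"
  using graded by (auto simp: graded_inclusion_def)

lemma UNIV_subalgebra: "subalgebra sA UNIV"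
  by (simp add: subalgebra_def)

lemma nabla_zero_part: "nabla \<in> zero_part sA nabla D2"
  using nabla_D2 by (simp add: degree_part_def commutator_def)

lemma submodule_nabla_stable:
  assumes "submodule sM act D2 W \<or> submodule sM act (zero_part sA nabla D2) W"
  shows "vec.subspace W" and "w \<in> W \<Longrightarrow> act nabla w \<in> W"
  using assms nabla_D2 nabla_zero_part by (auto simp: submodule_def)

text \<open>As \<open>nabla \<in> D2\<close>, the subalgebra is stable under \<open>[nabla, _]\<close> and so inherits the eigenspace
  decomposition of the whole algebra.\<close>

lemma D2_spanned_by_degree_parts: "D2 \<subseteq> alg.span (\<Union>n. degree_part sA nabla D2 n)"
proof -
  have "module_hom sA sA (commutator nabla)"
    by unfold_locales
      (simp_all add: commutator_def algebra_simps alg.scale_mult_left alg.scale_mult_right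
        alg.scale_right_diff_distrib)
  moreover have "alg.subspace D2" "\<And>P. P \<in> D2 \<Longrightarrow> commutator nabla P \<in> D2"
    using D2 nabla_D2 by (auto simp: subalgebra_def commutator_def alg.subspace_diff)
  ultimately have "D2 \<subseteq> alg.span {P \<in> D2. \<exists>c. commutator nabla P = sA c P}"
    using graded
    by (intro alg.stable_subspace_spanned_by_eigenvectors)
      (auto simp: graded_inclusion_def semisimple_operator_def)
  also have "\<dots> \<subseteq> alg.span (\<Union>n. degree_part sA nabla D2 n)"
  proof (rule alg.span_mono, rule subsetI)
    fix P assume "P \<in> {P \<in> D2. \<exists>c. commutator nabla P = sA c P}"
    then obtain c where P: "P \<in> D2" "commutator nabla P = sA c P" by blast
    show "P \<in> (\<Union>n. degree_part sA nabla D2 n)"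
    proof (cases "P = 0")
      case True
      with P show ?thesis by (auto simp: degree_part_def)
    next
      case False
      then have "c \<in> \<int>" using P graded by (auto simp: graded_inclusion_def)
      with P show ?thesis by (auto simp: degree_part_def elim!: Ints_cases)
    qed
  qed
  finally show ?thesis .
qed

lemma nabla_act_degree_part:
  assumes "P \<in> degree_part sA nabla D n"
  shows "act nabla (act P m) = act P (act nabla m) + sM (of_int n) (act P m)"
proof -
  have "nabla * P = P * nabla + sA (of_int n) P"
    using assms by (simp add: degree_part_def commutator_def algebra_simps)
  then show ?thesis by (metis act_mult act_add_left act_scale)
qed

lemma degree_part_shifts_eigenspace:
  assumes "P \<in> degree_part sA nabla D n" and "v \<in> eigenspace c"
  shows "act P v \<in> eigenspace (c + of_int n)"
  using assms by (simp add: nabla_act_degree_part act_scale_right vec.scale_left_distrib)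

lemma degree_part_shifts_eigenspaces:
  assumes P: "P \<in> degree_part sA nabla D n" and v: "v \<in> shifted_eigenspaces c k"
  shows "act P v \<in> shifted_eigenspaces c (k + n)"
  using v
proof (induction rule: vec.span_induct_alt)
  case base
  then show ?case by (simp add: act_zero_right vec.span_zero)
next
  case (step a x y)
  then obtain j where j: "k \<le> j" "x \<in> eigenspace (c + of_int j)" by auto
  have "act P x \<in> shifted_eigenspaces c (k + n)"
    using degree_part_shifts_eigenspace [OF P j(2)] j(1)
    by (intro vec.span_base) (auto intro!: exI [of _ "j + n"] simp: add.assoc)
  with step show ?case
    by (simp add: act_add_right act_scale_right vec.span_add vec.span_scale)
qed

lemma shifted_eigenspaces_antimono:
  "k \<le> l \<Longrightarrow> shifted_eigenspaces c l \<subseteq> shifted_eigenspaces c k"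
  using order_trans by (intro vec.span_mono) blast

lemma eigenspace_subset_shifted: "eigenspace c \<subseteq> shifted_eigenspaces c 0"
proof
  fix v assume "v \<in> eigenspace c"
  moreover have "c \<in> {c + of_int n |n. 0 \<le> n}"
    by (rule CollectI, rule exI [of _ 0]) simp
  ultimately show "v \<in> shifted_eigenspaces c 0"
    by (intro vec.span_base) blast
qed

lemma positive_image_eigenspace:
  assumes "X \<subseteq> eigenspace c"
  shows "positive_image X \<subseteq> shifted_eigenspaces c 1"
proof (rule vec.span_minimal)
  show "{act P x |P x n. P \<in> degree_part sA nabla D2 n \<and> n > 0 \<and> x \<in> X} \<subseteq> shifted_eigenspaces c 1"
  proof
    fix y assume "y \<in> {act P x |P x n. P \<in> degree_part sA nabla D2 n \<and> n > 0 \<and> x \<in> X}"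
    then obtain P x n where y: "y = act P x" "P \<in> degree_part sA nabla D2 n" "n > 0" "x \<in> X"
      by blast
    then have "y \<in> shifted_eigenspaces c (0 + n)"
      using degree_part_shifts_eigenspaces eigenspace_subset_shifted assms by blast
    then show "y \<in> shifted_eigenspaces c 1"
      using y(3) shifted_eigenspaces_antimono [of 1 n c] by auto
  qed
qed simp

lemma submodule_eigenspace:
  "submodule sM act (zero_part sA nabla D2) (eigenspace c)"
  using degree_part_shifts_eigenspace [of _ D2 0 _ c]
  by (auto simp: submodule_def vec.subspace_def act_zero_right act_add_right act_scale_right
      vec.scale_right_distrib mult.commute)

text \<open>The decomposition \<open>D2 X = X + D2\<^sup>+ X\<close>: the negative part of \<open>D2\<close> kills \<open>X\<close> and the part of degree zero
  preserves it.\<close>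

lemma generated_decomposition:
  assumes X: "submodule sM act (zero_part sA nabla D2) X" and "X \<subseteq> ann sA act nabla D2 UNIV"
    and y: "y \<in> generated sM act D2 X"
  obtains x z where "x \<in> X" "z \<in> positive_image X" "y = x + z"
proof -
  have X_span: "vec.span X = X" using X by (simp add: submodule_def)
  have "act P x \<in> vec.span (X \<union> positive_image X)" if x: "x \<in> X" and "P \<in> D2" for P x
  proof -
    have "P \<in> alg.span (\<Union>n. degree_part sA nabla D2 n)"
      using D2_spanned_by_degree_parts \<open>P \<in> D2\<close> by blast
    then show ?thesis
    proof (induction rule: alg.span_induct_alt)
      case base
      then show ?case by (simp add: act_zero_left vec.span_zero)
    next
      case (step a R P)
      then obtain n where R: "R \<in> degree_part sA nabla D2 n" by blast
      consider "n < 0" | "n = 0" | "n > 0" by linarith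
      then have "act R x \<in> vec.span (X \<union> positive_image X)"
      proof cases
        case 1
        then have "R \<in> negative_part sA nabla D2"
          unfolding negative_part_def using R by (intro alg.span_base) auto
        then have "act R x = 0" using assms x by (auto simp: ann_def)
        then show ?thesis by (simp add: vec.span_zero)
      next
        case 2
        then have "act R x \<in> X" using R X x by (auto simp: submodule_def)
        then show ?thesis by (intro vec.span_base) auto
      next
        case 3
        then have "act R x \<in> positive_image X" using R x by (intro vec.span_base) auto
        then show ?thesis by (intro vec.span_base) auto
      qed
      with step show ?case
        by (simp add: act_add_left act_scale vec.span_add vec.span_scale)
    qed
  qed
  then have "generated sM act D2 X \<subseteq> vec.span (X \<union> positive_image X)"
    unfolding generated_def by (intro vec.span_minimal) auto
  with y have "y \<in> vec.span (X \<union> positive_image X)" by blast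
  then show thesis
    using that unfolding vec.span_Un vec.span_span X_span by blast
qed

lemma subset_generated: "X \<subseteq> generated sM act D2 X"
proof
  fix x assume "x \<in> X"
  moreover have "1 \<in> D2" using D2 by (simp add: subalgebra_def)
  ultimately have "act 1 x \<in> generated sM act D2 X"
    unfolding generated_def by (intro vec.span_base) blast
  then show "x \<in> generated sM act D2 X" by (simp add: act_one)
qed

lemma lowest_component_in_submodule:
  assumes "submodule sM act D2 W" and "v \<in> eigenspace c" and "u \<in> shifted_eigenspaces c 1"
    and "v + u \<in> W"
  shows "v \<in> W"
proof (rule vec.eigenvector_in_stable_subspace [OF act_linear, where u = u])
  show "act nabla v = sM c v" using assms by simp
  show "c \<notin> {c + of_int n |n. 1 \<le> n}" by simp
qed (use assms submodule_nabla_stable in auto)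

text \<open>This reduces the vanishing of a \<open>nabla\<close>-stable subspace to eigenvectors.\<close>

lemma stable_subspace_zero:
  assumes W: "vec.subspace W" "\<And>w. w \<in> W \<Longrightarrow> act nabla w \<in> W"
    and "\<And>c. W \<inter> eigenspace c \<subseteq> {0}"
  shows "W \<subseteq> {0}"
proof -
  have "W \<subseteq> vec.span {w \<in> W. \<exists>c. act nabla w = sM c w}"
    using nabla_semisimple W
    by (intro vec.stable_subspace_spanned_by_eigenvectors [OF act_linear])
      (auto simp: semisimple_operator_def)
  also have "\<dots> \<subseteq> vec.span {0}"
    using assms(3) by (intro vec.span_mono) auto
  finally show ?thesis by simp
qed

lemma positive_image_nabla_stable:
  assumes "w \<in> positive_image UNIV"
  shows "act nabla w \<in> positive_image UNIV"
  using assms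
proof (induction rule: vec.span_induct_alt)
  case base
  then show ?case by (simp add: act_zero_right vec.span_zero)
next
  case (step a x y)
  then obtain P m n where P: "x = act P m" "P \<in> degree_part sA nabla D2 n" "n > 0" by blast
  have gen: "act P m' \<in> positive_image UNIV" for m'
    using P by (intro vec.span_base) auto
  have "act nabla x \<in> positive_image UNIV"
    unfolding P(1) nabla_act_degree_part [OF P(2)] by (intro vec.span_add vec.span_scale gen)
  with step show ?case
    by (simp add: act_add_right act_scale_right vec.span_add vec.span_scale)
qed


section \<open>Lowest weight vectors and the modules that they generate\<close>

lemma submodule_ann_D2: "submodule sM act (zero_part sA nabla D2) (ann sA act nabla D2 UNIV)"
  by (rule submodule_ann [OF D2]) (simp add: submodule_def)

text \<open>A lowest weight vector \<open>a\<close> of eigenvalue \<open>c\<close> is nonzero modulo a suitable maximal submodule \<open>Q\<close>. The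
  quotient by \<open>Q\<close> is then generated by vectors of eigenvalue \<open>c\<close>, so \<open>D2\<^sup>+\<close> only reaches larger
  eigenvalues in it.\<close>

lemma ann_inter_positive_image:
  assumes ss: "semisimple_submodule sM act D2 UNIV"
  shows "ann sA act nabla D2 UNIV \<inter> positive_image UNIV \<subseteq> {0}"
proof (rule stable_subspace_zero)
  show "vec.subspace (ann sA act nabla D2 UNIV \<inter> positive_image UNIV)"
    using submodule_ann_D2 by (simp add: submodule_def vec.subspace_inter)
  show "act nabla w \<in> ann sA act nabla D2 UNIV \<inter> positive_image UNIV"
    if "w \<in> ann sA act nabla D2 UNIV \<inter> positive_image UNIV" for w
    using that submodule_nabla_stable(2) submodule_ann_D2 positive_image_nabla_stable by blast
next
  fix c
  define X where "X = ann sA act nabla D2 UNIV \<inter> eigenspace c"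
  have X: "submodule sM act (zero_part sA nabla D2) X"
    unfolding X_def by (intro submodule_Int submodule_ann_D2 submodule_eigenspace)
  show "ann sA act nabla D2 UNIV \<inter> positive_image UNIV \<inter> eigenspace c \<subseteq> {0}"
  proof (rule subsetI, rule ccontr)
    fix a assume a: "a \<in> ann sA act nabla D2 UNIV \<inter> positive_image UNIV \<inter> eigenspace c"
      and "a \<notin> {0}"
    then obtain Q where Q: "submodule sM act D2 Q" "a \<notin> Q"
      "\<And>L m. submodule sM act D2 L \<Longrightarrow> \<not> L \<subseteq> Q \<Longrightarrow> \<exists>l\<in>L. \<exists>q\<in>Q. m = l + q"
      using semisimple_maximal_submodule_avoiding [OF ss, of a] by auto
    have L: "generated sM act D2 X \<subseteq> shifted_eigenspaces c 0"
    proof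
      fix y assume "y \<in> generated sM act D2 X"
      then obtain x z where y: "x \<in> X" "z \<in> positive_image X" "y = x + z"
        using generated_decomposition [OF X] unfolding X_def by blast
      have "x \<in> shifted_eigenspaces c 0"
        using y(1) eigenspace_subset_shifted by (auto simp: X_def)
      moreover have "z \<in> shifted_eigenspaces c 0"
        using y(2) positive_image_eigenspace [of X c] shifted_eigenspaces_antimono [of 0 1 c]
        by (auto simp: X_def)
      ultimately show "y \<in> shifted_eigenspaces c 0"
        unfolding y(3) by (rule vec.span_add)
    qed
    have "a \<in> generated sM act D2 X"
      using a subset_generated [of X] by (auto simp: X_def)
    then have split: "\<exists>l\<in>generated sM act D2 X. \<exists>q\<in>Q. m = l + q" for m
      using Q submodule_generated [OF D2] by blast
    \<comment> \<open>Splitting \<open>m = l + q\<close> in \<open>P m\<close> gives \<open>D2\<^sup>+ M \<subseteq> D2\<^sup>+ L + Q\<close>, where \<open>L\<close> is generated by \<open>X\<close>.\<close>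
    have "positive_image UNIV \<subseteq> vec.span (shifted_eigenspaces c 1 \<union> Q)"
    proof (rule vec.span_minimal, rule subsetI)
      fix y assume "y \<in> {act P x |P x n. P \<in> degree_part sA nabla D2 n \<and> n > 0 \<and> x \<in> UNIV}"
      then obtain P m n where y: "y = act P m" "P \<in> degree_part sA nabla D2 n" "n > 0" by blast
      obtain l q where m: "l \<in> generated sM act D2 X" "q \<in> Q" "m = l + q" using split by blast
      have "act P l \<in> shifted_eigenspaces c (0 + n)"
        using degree_part_shifts_eigenspaces y(2) m(1) L by blast
      then have "act P l \<in> shifted_eigenspaces c 1"
        using y(3) shifted_eigenspaces_antimono [of 1 n c] by auto
      moreover have "act P q \<in> Q"
        using y(2) m(2) Q(1) by (auto simp: submodule_def degree_part_def)
      ultimately show "y \<in> vec.span (shifted_eigenspaces c 1 \<union> Q)"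
        unfolding y(1) m(3) act_add_right by (intro vec.span_add vec.span_base) auto
    qed simp
    then have "a \<in> vec.span (shifted_eigenspaces c 1 \<union> Q)" using a by blast
    moreover have "vec.span Q = Q" using Q(1) by (simp add: submodule_def)
    ultimately obtain u q where u: "u \<in> shifted_eigenspaces c 1" "q \<in> Q" "a = u + q"
      unfolding vec.span_Un vec.span_span by auto
    then have "a + (- u) \<in> Q" by simp
    then have "a \<in> Q"
      using lowest_component_in_submodule [OF Q(1), of a c "- u"] a u(1) vec.span_neg by blast
    with Q show False by blast
  qed
qed

text \<open>Since \<open>D2 X = X + D2\<^sup>+ X\<close>, an annihilated vector of \<open>D2 X\<close> differs from an element of \<open>X\<close> by an
  annihilated vector of \<open>D2\<^sup>+ X\<close>, which is zero.\<close>

lemma ann_generated: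
  assumes ss: "semisimple_submodule sM act D2 UNIV"
    and X: "submodule sM act (zero_part sA nabla D2) X" "X \<subseteq> ann sA act nabla D2 UNIV"
  shows "ann sA act nabla D2 (generated sM act D2 X) = X"
proof
  show "X \<subseteq> ann sA act nabla D2 (generated sM act D2 X)"
    using X(2) subset_generated [of X] by (auto simp: ann_def)
  show "ann sA act nabla D2 (generated sM act D2 X) \<subseteq> X"
  proof
    fix y assume y: "y \<in> ann sA act nabla D2 (generated sM act D2 X)"
    then obtain x z where xz: "x \<in> X" "z \<in> positive_image X" "y = x + z"
      using generated_decomposition [OF X] by (auto simp: ann_def)
    have "y \<in> ann sA act nabla D2 UNIV" "x \<in> ann sA act nabla D2 UNIV"
      using y xz X by (auto simp: ann_def)
    then have "y - x \<in> ann sA act nabla D2 UNIV"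
      using submodule_ann_D2 by (metis submodule_def vec.subspace_diff)
    moreover have "positive_image X \<subseteq> positive_image UNIV"
      by (intro vec.span_mono) auto
    ultimately have "z = 0"
      using ann_inter_positive_image [OF ss] xz by auto
    with xz show "y \<in> X" by simp
  qed
qed

text \<open>\<open>nabla\<close> commutes with \<open>D2\<^sup>0\<close>, so its eigenspaces cut out \<open>D2\<^sup>0\<close>-submodules of \<open>X\<close>.\<close>

lemma simple_submodule_in_eigenspace:
  assumes "simple_submodule sM act (zero_part sA nabla D2) X"
  obtains c where "X \<subseteq> eigenspace c"
proof -
  have X: "submodule sM act (zero_part sA nabla D2) X" "X \<noteq> {0}"
    and min: "\<And>K. submodule sM act (zero_part sA nabla D2) K \<Longrightarrow> K \<subseteq> X \<Longrightarrow> K = {0} \<or> K = X"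
    using assms by (auto simp: simple_submodule_def)
  have "0 \<in> X" using X(1) by (simp add: submodule_def vec.subspace_0)
  with X(2) have "\<not> X \<subseteq> {0}" by auto
  then obtain c where c: "\<not> X \<inter> eigenspace c \<subseteq> {0}"
    using stable_subspace_zero [of X] submodule_nabla_stable X(1) by blast
  have "X \<inter> eigenspace c = X"
    using min [of "X \<inter> eigenspace c"] submodule_Int [OF X(1) submodule_eigenspace] c by blast
  then show thesis using that by blast
qed

text \<open>A submodule of \<open>D2 X\<close> that misses \<open>X\<close> lives in eigenvalues larger than that of \<open>X\<close>. If it were
  nonzero, it would generate \<open>M\<close> together with some maximal submodule \<open>Q\<close>; then \<open>X\<close>, having a smaller
  eigenvalue, would lie in \<open>Q\<close>, and so would all of \<open>D2 X\<close>.\<close>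

lemma simple_generated:
  assumes ss: "semisimple_submodule sM act D2 UNIV"
    and simple: "simple_submodule sM act (zero_part sA nabla D2) X"
    and ann: "X \<subseteq> ann sA act nabla D2 UNIV"
  shows "simple_submodule sM act D2 (generated sM act D2 X)"
  unfolding simple_submodule_def
proof (intro conjI allI impI)
  have X: "submodule sM act (zero_part sA nabla D2) X" "X \<noteq> {0}"
    and min: "\<And>K. submodule sM act (zero_part sA nabla D2) K \<Longrightarrow> K \<subseteq> X \<Longrightarrow> K = {0} \<or> K = X"
    using simple by (auto simp: simple_submodule_def)
  have "0 \<in> X" using X(1) by (simp add: submodule_def vec.subspace_0)
  show "submodule sM act D2 (generated sM act D2 X)"
    by (rule submodule_generated [OF D2])
  show "generated sM act D2 X \<noteq> {0}"
    using X(2) \<open>0 \<in> X\<close> subset_generated [of X] by auto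
  fix L assume "submodule sM act D2 L \<and> L \<subseteq> generated sM act D2 X"
  then have L: "submodule sM act D2 L" and LJ: "L \<subseteq> generated sM act D2 X" by auto
  have "submodule sM act (zero_part sA nabla D2) L"
    using L by (auto simp: submodule_def degree_part_def)
  then have "L \<inter> X = {0} \<or> L \<inter> X = X"
    using min submodule_Int [OF _ X(1)] by simp
  then show "L = {0} \<or> L = generated sM act D2 X"
  proof
    assume "L \<inter> X = X"
    then have "generated sM act D2 X \<subseteq> L"
      using generated_subset_submodule [OF L] by blast
    with LJ show ?thesis by blast
  next
    assume LX: "L \<inter> X = {0}"
    obtain c where c: "X \<subseteq> eigenspace c"
      using simple_submodule_in_eigenspace [OF simple] .
    have L_high: "L \<subseteq> shifted_eigenspaces c 1"
    proof
      fix l assume l: "l \<in> L"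
      then obtain x z where xz: "x \<in> X" "z \<in> positive_image X" "l = x + z"
        using generated_decomposition [OF X(1) ann] LJ by blast
      have z: "z \<in> shifted_eigenspaces c 1"
        using xz(2) positive_image_eigenspace [OF c] by blast
      have "x \<in> L"
        using lowest_component_in_submodule [OF L _ z, of x] xz l c by blast
      then have "x = 0" using LX xz(1) by blast
      with z xz(3) show "l \<in> shifted_eigenspaces c 1" by simp
    qed
    have "l = 0" if l: "l \<in> L" for l
    proof (rule ccontr)
      assume "l \<noteq> 0"
      then obtain Q where Q: "submodule sM act D2 Q" "l \<notin> Q"
        "\<And>L m. submodule sM act D2 L \<Longrightarrow> \<not> L \<subseteq> Q \<Longrightarrow> \<exists>l\<in>L. \<exists>q\<in>Q. m = l + q"
        using semisimple_maximal_submodule_avoiding [OF ss, of l] by blast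
      have "x \<in> Q" if x: "x \<in> X" for x
      proof -
        obtain k q where k: "k \<in> L" "q \<in> Q" "x = k + q"
          using Q(3) [OF L, of x] l Q(2) by blast
        then have "x + (- k) \<in> Q" by simp
        then show ?thesis
          using lowest_component_in_submodule [OF Q(1), of x c "- k"] c x k(1) L_high vec.span_neg
          by blast
      qed
      then have "generated sM act D2 X \<subseteq> Q"
        using generated_subset_submodule [OF Q(1)] by blast
      with LJ l Q(2) show False by blast
    qed
    moreover have "0 \<in> L" using L by (simp add: submodule_def vec.subspace_0)
    ultimately show ?thesis by blast
  qed
qed


section \<open>Restriction from the whole algebra to the subalgebra\<close>

lemma ann_UNIV_subset_ann_D2: "ann sA act nabla UNIV N \<subseteq> ann sA act nabla D2 UNIV"
proof -
  have "negative_part sA nabla D2 \<subseteq> negative_part sA nabla UNIV"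
    unfolding negative_part_def by (intro alg.span_mono) (auto simp: degree_part_def)
  then show ?thesis by (auto simp: ann_def)
qed

lemma submodule_ann_UNIV:
  assumes "submodule sM act UNIV N"
  shows "submodule sM act (zero_part sA nabla D2) (ann sA act nabla UNIV N)"
  using submodule_ann [OF UNIV_subalgebra assms, of nabla]
  by (auto simp: submodule_def degree_part_def)

end

theorem theorem4p1:
  fixes sA :: "complex \<Rightarrow> 'a::ring_1 \<Rightarrow> 'a"
    and sM :: "complex \<Rightarrow> 'm::ab_group_add \<Rightarrow> 'm"
    and act :: "'a \<Rightarrow> 'm \<Rightarrow> 'm"
    and nabla :: 'a and D2 :: "'a set" and N :: "'m set"
  assumes "graded_inclusion sA nabla D2"
    and "algebra_module sA sM act"
    and "semisimple_operator sM (act nabla)"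
    and "semisimple_submodule sM act UNIV UNIV"
    and "semisimple_submodule sM act D2 UNIV"
    and "generated sM act D2 (ann sA act nabla D2 UNIV) = UNIV"
    and "submodule sM act UNIV N"
  shows "(simple_submodule sM act (zero_part sA nabla D2) (ann sA act nabla UNIV N) \<longrightarrow>
            simple_submodule sM act D2 (J_plus sA sM act nabla D2 N)) \<and>
         (vector_space.dim sM (ann sA act nabla UNIV N) = 1 \<longrightarrow>
            simple_submodule sM act (zero_part sA nabla D2) (ann sA act nabla UNIV N) \<and>
            simple_submodule sM act D2 (J_plus sA sM act nabla D2 N)) \<and>
         ann sA act nabla UNIV N = ann sA act nabla D2 (J_plus sA sM act nabla D2 N)"
proof -
  interpret algebra_module sA sM act by (fact assms(2))
  interpret graded_module sA sM act nabla D2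
    by unfold_locales (use assms in auto)
  let ?X = "ann sA act nabla UNIV N"
  have X: "submodule sM act (zero_part sA nabla D2) ?X"
    using submodule_ann_UNIV assms(7) by blast
  have "ann sA act nabla D2 (J_plus sA sM act nabla D2 N) = ?X"
    unfolding J_plus_def by (rule ann_generated [OF assms(5) X ann_UNIV_subset_ann_D2])
  moreover have "simple_submodule sM act D2 (J_plus sA sM act nabla D2 N)"
    if "simple_submodule sM act (zero_part sA nabla D2) ?X"
    unfolding J_plus_def by (rule simple_generated [OF assms(5) that ann_UNIV_subset_ann_D2])
  moreover have "simple_submodule sM act (zero_part sA nabla D2) ?X" if "vec.dim ?X = 1"
    using one_dimensional_submodule_simple [OF X that] .
  ultimately show ?thesis by simp
qed

end
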